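(* Suppose that there exist $C,c>0$ such that for every $\epsilon>0$ small enough and all $n\in\mathbb N$ we have $$\widehat\mu(S_nA\ge\epsilon n)\le Ce^{-c\epsilon^2n}.$$ Then for every $\epsilon>0$ and $1\le p<\infty$ there exists a random variable $K_p\in L^p(\mu)$ such that for $\mu$-a.a. $\omega$ and all $n\in\mathbb N$ we have $$\widehat\mu_\omega(S_n^\omega A\ge\epsilon n)\le K_p(\omega)e^{-\epsilon^2\frac{c}{p+2}n}.$$
   Context: Let $(\Sigma,\mathcal F,\mu)$ be a probability space and $T:\Sigma\to\Sigma$ a measurable $\mu$-preserving map. Let $X$ be a measurable space and $X_\omega\subset X$, $\omega\in\Sigma$, subsets such that $\mathcal E=\{(\omega,x):\omega\in\Sigma,\ x\in X_\omega\}$ is a measurable subset of $\Sigma\times X$. Let $f_\omega:X_\omega\to X_{T\omega}$ be maps such that $F_1:\mathcal E\to\mathcal E$, $F_1(\omega,x)=(T\omega,f_\omega x)$, is measurable. Fix a probability measure $\widehat\mu=\int\widehat\mu_\omega\,d\mu(\omega)$ on $\mathcal E$, where $\widehat\mu_\omega$ is a probability measure on $X_\omega$. Let $A:X\to\mathbb R$ be measurable, $S_n^\omega A=\sum_{j=0}^{n-1}A\circ f_{T^{j-1}\omega}\circ\cdots\circ f_{T\omega}\circ f_\omega$ (the $j=0$ term being $A$), and $S_nA(\omega,x)=S_n^\omega A(x)$.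
   Formalization: The conclusion is proved for every ε in the range 0<ε<ε₀ on which the hypothesis is assumed, not for every ε>0; with the same c, the claim for large ε is false (e.g. sums of i.i.d. centered exponential variables). *)

theory Defs
  imports "HOL-Probability.Probability"
begin

primrec fiber_iterate :: "('w \<Rightarrow> 'w) \<Rightarrow> ('w \<Rightarrow> 'x \<Rightarrow> 'x) \<Rightarrow> nat \<Rightarrow> 'w \<Rightarrow> 'x \<Rightarrow> 'x" where
  "fiber_iterate T f 0 \<omega> = id"
| "fiber_iterate T f (Suc j) \<omega> = f ((T ^^ j) \<omega>) \<circ> fiber_iterate T f j \<omega>"

definition fiber_sum ::
    "('w \<Rightarrow> 'w) \<Rightarrow> ('w \<Rightarrow> 'x \<Rightarrow> 'x) \<Rightarrow> ('x \<Rightarrow> real) \<Rightarrow> nat \<Rightarrow> 'w \<Rightarrow> 'x \<Rightarrow> real" where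
  "fiber_sum T f A n \<omega> x = (\<Sum>j<n. A (fiber_iterate T f j \<omega> x))"

definition skew_product :: "('w \<Rightarrow> 'w) \<Rightarrow> ('w \<Rightarrow> 'x \<Rightarrow> 'x) \<Rightarrow> 'w \<times> 'x \<Rightarrow> 'w \<times> 'x" where
  "skew_product T f = (\<lambda>(\<omega>, x). (T \<omega>, f \<omega> x))"

definition fibered_space ::
    "'w measure \<Rightarrow> 'x measure \<Rightarrow> ('w \<Rightarrow> 'x set) \<Rightarrow> ('w \<times> 'x) measure" where
  "fibered_space M X XX = restrict_space (M \<Otimes>\<^sub>M X) (SIGMA \<omega>:space M. XX \<omega>)"

text \<open>
  The identity \<open>\<mu>h = \<integral> \<nu> \<omega> d\<mu>(\<omega>)\<close> on the fibered space, with \<open>\<nu> \<omega>\<close> a probability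
  measure on the fiber over \<open>\<omega>\<close>. Measurability of \<open>\<omega> \<mapsto> \<nu> \<omega> (B\<^sub>\<omega>)\<close>, which is
  what gives the integral its meaning, is required explicitly, because
  \<open>\<integral>\<^sup>+\<close> is also defined (as a lower integral) for functions that are not measurable.
\<close>

definition fiber_disintegration ::
    "'w measure \<Rightarrow> 'x measure \<Rightarrow> ('w \<Rightarrow> 'x set) \<Rightarrow> ('w \<Rightarrow> 'x measure)
      \<Rightarrow> ('w \<times> 'x) measure \<Rightarrow> bool" where
  "fiber_disintegration M X XX \<nu> \<mu>h \<longleftrightarrow>
     prob_space \<mu>h \<and> sets \<mu>h = sets (fibered_space M X XX) \<and>
     (\<forall>\<omega>\<in>space M. prob_space (\<nu> \<omega>) \<and> sets (\<nu> \<omega>) = sets (restrict_space X (XX \<omega>))) \<and>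
     (\<forall>B\<in>sets \<mu>h.
        (\<lambda>\<omega>. emeasure (\<nu> \<omega>) (Pair \<omega> -` B)) \<in> borel_measurable M \<and>
        emeasure \<mu>h B = (\<integral>\<^sup>+\<omega>. emeasure (\<nu> \<omega>) (Pair \<omega> -` B) \<partial>M))"

end

theory Submission
  imports Defs
begin

text \<open>
  For fixed \<open>\<epsilon>\<close> let \<open>g n \<omega>\<close> be the fiberwise probability of the \<open>n\<close>-th large deviation event
  and \<open>b = c \<epsilon>\<^sup>2\<close>. By the disintegration, \<open>g n\<close> has mean at most \<open>C exp (- b n)\<close>, and the
  task is to turn decay of means into almost sure decay with a random prefactor. With
  \<open>\<delta> = b / (p + 2)\<close>, put
    \<open>K = (\<Sum>n\<ge>1. g n exp (p \<delta> n)) powr (1 / p)\<close>.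
  Because \<open>p \<delta> < b\<close>, the series has finite mean, being dominated by the geometric series
  \<open>\<Sum>n\<ge>1. C exp (- (b - p \<delta>) n)\<close>; this says that \<open>K\<close> belongs to \<open>L\<^sup>p\<close> and is almost surely given
  by a convergent series. A probability satisfies \<open>(g n) powr p \<le> g n\<close>, so a single term
  of the series already bounds \<open>(g n exp (\<delta> n)) powr p\<close>, which is the desired inequality
  after taking \<open>p\<close>-th roots (\<open>exponential_decay_random_prefactor\<close>).

  The events are measurable because the Birkhoff sum along the fibers is a Birkhoff sum for
  the skew product on the fibered space (\<open>fiber_sum_measurable\<close>); the disintegration then
  makes each \<open>g n\<close> a random variable.
\<close>

section \<open>From decay of means to almost sure decay\<close>

text \<open>
  Values in \<open>[0, 1]\<close> are what makes the rate \<open>\<delta>\<close> available for every \<open>\<delta> < b / p\<close>: they give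
  control of the \<open>p\<close>-th moment of \<open>g n\<close> by its mean. The index \<open>n = 0\<close> is left out to match
  the tail bound, so the series runs over \<open>Suc n\<close>.
\<close>
lemma exponential_decay_random_prefactor:
  fixes M :: "'a measure" and g :: "nat \<Rightarrow> 'a \<Rightarrow> real" and C b \<delta> p :: real
  assumes meas: "\<And>n. n \<ge> 1 \<Longrightarrow> g n \<in> borel_measurable M"
    and nonneg: "\<And>n \<omega>. \<omega> \<in> space M \<Longrightarrow> 0 \<le> g n \<omega>"
    and le_one: "\<And>n \<omega>. \<omega> \<in> space M \<Longrightarrow> g n \<omega> \<le> 1"
    and mean: "\<And>n. n \<ge> 1 \<Longrightarrow> (\<integral>\<^sup>+\<omega>. ennreal (g n \<omega>) \<partial>M) \<le> ennreal (C * exp (- b * real n))"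
    and "C \<ge> 0" "p \<ge> 1" "p * \<delta> < b"
  shows "\<exists>K. K \<in> borel_measurable M \<and> integrable M (\<lambda>\<omega>. \<bar>K \<omega>\<bar> powr p) \<and>
           (AE \<omega> in M. \<forall>n\<ge>1. g n \<omega> \<le> K \<omega> * exp (- \<delta> * real n))"
proof -
  define h where "h n \<omega> = ennreal (g (Suc n) \<omega> * exp (p * \<delta> * real (Suc n)))" for n \<omega>
  define H where "H \<omega> = (\<Sum>n. h n \<omega>)" for \<omega>
  \<comment> \<open>Where the series diverges, \<open>enn2real\<close> makes \<open>K\<close> vanish and the bound may fail;
      \<open>H_finite\<close> shows that this happens on a null set only.\<close>
  define K where "K \<omega> = enn2real (H \<omega>) powr (1 / p)" for \<omega>
  define r where "r = exp (p * \<delta> - b)"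
  have p0: "p > 0" using \<open>p \<ge> 1\<close> by simp
  have [measurable]: "g (Suc n) \<in> borel_measurable M" for n
    using meas by simp
  have h_meas [measurable]: "h n \<in> borel_measurable M" for n
    unfolding h_def by measurable
  have H_meas [measurable]: "H \<in> borel_measurable M"
    unfolding H_def by measurable
  have K_meas: "K \<in> borel_measurable M"
    unfolding K_def by measurable
  have h_mean: "(\<integral>\<^sup>+\<omega>. h n \<omega> \<partial>M) \<le> ennreal (C * r ^ Suc n)" for n
  proof -
    have "(\<integral>\<^sup>+\<omega>. h n \<omega> \<partial>M)
        = (\<integral>\<^sup>+\<omega>. ennreal (exp (p * \<delta> * real (Suc n))) * ennreal (g (Suc n) \<omega>) \<partial>M)"
      by (intro nn_integral_cong) (simp add: h_def ennreal_mult nonneg mult.commute)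
    also have "\<dots> = ennreal (exp (p * \<delta> * real (Suc n))) * (\<integral>\<^sup>+\<omega>. ennreal (g (Suc n) \<omega>) \<partial>M)"
      by (intro nn_integral_cmult) measurable
    also have "\<dots> \<le> ennreal (exp (p * \<delta> * real (Suc n))) * ennreal (C * exp (- b * real (Suc n)))"
      using mean[of "Suc n"] by (intro mult_left_mono) auto
    also have "\<dots> = ennreal (C * (exp (p * \<delta> * real (Suc n)) * exp (- b * real (Suc n))))"
      using \<open>C \<ge> 0\<close> by (subst ennreal_mult[symmetric]) (auto simp: mult_ac)
    also have "exp (p * \<delta> * real (Suc n)) * exp (- b * real (Suc n)) = r ^ Suc n"
      unfolding r_def exp_of_nat_mult[symmetric] exp_add[symmetric]
      by (simp add: algebra_simps)
    finally show ?thesis .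
  qed
  have r: "0 \<le> r" "r < 1"
    using \<open>p * \<delta> < b\<close> by (auto simp: r_def)
  have "summable (\<lambda>n. C * r ^ Suc n)"
    using r by (intro summable_mult summable_Suc_iff[THEN iffD2] summable_geometric) auto
  then have geometric_finite: "(\<Sum>n. ennreal (C * r ^ Suc n)) < \<infinity>"
    using r \<open>C \<ge> 0\<close> by (subst suminf_ennreal2) auto
  have H_mean: "(\<integral>\<^sup>+\<omega>. H \<omega> \<partial>M) < \<infinity>"
  proof -
    have "(\<integral>\<^sup>+\<omega>. H \<omega> \<partial>M) = (\<Sum>n. \<integral>\<^sup>+\<omega>. h n \<omega> \<partial>M)"
      unfolding H_def by (intro nn_integral_suminf h_meas)
    also have "\<dots> \<le> (\<Sum>n. ennreal (C * r ^ Suc n))"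
      by (intro suminf_le h_mean) auto
    finally show ?thesis using geometric_finite by (rule le_less_trans)
  qed
  have H_finite: "AE \<omega> in M. H \<omega> \<noteq> \<infinity>"
    using H_mean by (intro nn_integral_PInf_AE) auto
  have K_power: "\<bar>K \<omega>\<bar> powr p = enn2real (H \<omega>)" for \<omega>
    using p0 by (simp add: K_def powr_powr)
  have "(\<integral>\<^sup>+\<omega>. ennreal (enn2real (H \<omega>)) \<partial>M) \<le> (\<integral>\<^sup>+\<omega>. H \<omega> \<partial>M)"
    by (intro nn_integral_mono) (simp add: ennreal_enn2real_if)
  then have "integrable M (\<lambda>\<omega>. enn2real (H \<omega>))"
    using H_mean by (intro integrableI_nonneg) auto
  then have "integrable M (\<lambda>\<omega>. \<bar>K \<omega>\<bar> powr p)"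
    by (simp add: K_power)
  moreover have "AE \<omega> in M. \<forall>n\<ge>1. g n \<omega> \<le> K \<omega> * exp (- \<delta> * real n)"
    using H_finite AE_space
  proof eventually_elim
    fix \<omega> assume fin: "H \<omega> \<noteq> \<infinity>" and \<omega>: "\<omega> \<in> space M"
    show "\<forall>n\<ge>1. g n \<omega> \<le> K \<omega> * exp (- \<delta> * real n)"
    proof (intro allI impI)
      fix n :: nat assume "n \<ge> 1"
      then obtain m where n: "n = Suc m" by (cases n) auto
      have "h m \<omega> \<le> H \<omega>"
        unfolding H_def using sum_le_suminf[of "\<lambda>n. h n \<omega>" "{m}"] by simp
      then have "enn2real (h m \<omega>) \<le> enn2real (H \<omega>)"
        using fin by (intro enn2real_mono) (auto simp: top.not_eq_extremum)
      then have term_le: "g n \<omega> * exp (p * \<delta> * real n) \<le> enn2real (H \<omega>)"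
        using nonneg[OF \<omega>] by (simp add: h_def n)
      have "g n \<omega> powr p \<le> g n \<omega>"
        using nonneg[OF \<omega>, of n] le_one[OF \<omega>, of n] \<open>p \<ge> 1\<close> powr_mono'[of 1 p "g n \<omega>"] by simp
      then have "g n \<omega> powr p * exp (p * \<delta> * real n) \<le> enn2real (H \<omega>)"
        by (intro order_trans[OF _ term_le] mult_right_mono) auto
      then have "(g n \<omega> * exp (\<delta> * real n)) powr p \<le> enn2real (H \<omega>)"
        using nonneg[OF \<omega>] by (simp add: powr_mult exp_powr_real mult_ac)
      then have "((g n \<omega> * exp (\<delta> * real n)) powr p) powr (1 / p) \<le> K \<omega>"
        unfolding K_def using p0 by (intro powr_mono2) auto
      then have "g n \<omega> * exp (\<delta> * real n) \<le> K \<omega>"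
        using nonneg[OF \<omega>] p0 by (simp add: powr_powr)
      then show "g n \<omega> \<le> K \<omega> * exp (- \<delta> * real n)"
        by (simp add: exp_minus field_simps)
    qed
  qed
  ultimately show ?thesis using K_meas by blast
qed

section \<open>Birkhoff sums along the fibers\<close>

lemma skew_product_funpow:
  "(skew_product T f ^^ j) (\<omega>, x) = ((T ^^ j) \<omega>, fiber_iterate T f j \<omega> x)"
  by (induction j) (auto simp: skew_product_def)

lemma space_fibered_space:
  assumes "\<And>\<omega>. \<omega> \<in> space M \<Longrightarrow> XX \<omega> \<subseteq> space X"
  shows "space (fibered_space M X XX) = (SIGMA \<omega>:space M. XX \<omega>)"
  using assms by (auto simp: fibered_space_def space_restrict_space space_pair_measure)

text \<open>
  The \<open>j\<close>-th fiber iterate is the second coordinate of the \<open>j\<close>-th power of the skew product,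
  so measurability jointly in \<open>\<omega>\<close> and \<open>x\<close> passes from the skew product to the sum.
\<close>
lemma fiber_sum_measurable:
  assumes F: "skew_product T f \<in> measurable (fibered_space M X XX) (fibered_space M X XX)"
    and A: "A \<in> borel_measurable X"
  shows "(\<lambda>(\<omega>, x). fiber_sum T f A n \<omega> x) \<in> borel_measurable (fibered_space M X XX)"
proof -
  let ?E = "fibered_space M X XX"
  have pow: "(skew_product T f ^^ j) \<in> measurable ?E ?E" for j
    using measurable_compose_n[OF F] .
  have "snd \<in> measurable ?E X"
    unfolding fibered_space_def by (intro measurable_restrict_space1 measurable_snd)
  then have "(\<lambda>z. A (snd ((skew_product T f ^^ j) z))) \<in> borel_measurable ?E" for j
    by (intro measurable_compose[OF pow] measurable_compose[OF _ A])
  then have "(\<lambda>z. \<Sum>j<n. A (snd ((skew_product T f ^^ j) z))) \<in> borel_measurable ?E"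
    by (intro borel_measurable_sum)
  also have "(\<lambda>z. \<Sum>j<n. A (snd ((skew_product T f ^^ j) z))) = (\<lambda>(\<omega>, x). fiber_sum T f A n \<omega> x)"
    by (auto simp: fun_eq_iff skew_product_funpow fiber_sum_def)
  finally show ?thesis .
qed

section \<open>Quenched large deviations from annealed ones\<close>

theorem theorem2p13:
  fixes M :: "'w measure" and T :: "'w \<Rightarrow> 'w"
    and X :: "'x measure" and XX :: "'w \<Rightarrow> 'x set" and f :: "'w \<Rightarrow> 'x \<Rightarrow> 'x"
    and \<mu>h :: "('w \<times> 'x) measure" and \<nu> :: "'w \<Rightarrow> 'x measure"
    and A :: "'x \<Rightarrow> real" and C c \<epsilon>\<^sub>0 :: real
  assumes "prob_space M"
    and "T \<in> measurable M M" and "distr M M T = M"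
    and "\<And>\<omega>. \<omega> \<in> space M \<Longrightarrow> XX \<omega> \<subseteq> space X"
    and "(SIGMA \<omega>:space M. XX \<omega>) \<in> sets (M \<Otimes>\<^sub>M X)"
    and "\<And>\<omega>. \<omega> \<in> space M \<Longrightarrow> f \<omega> \<in> XX \<omega> \<rightarrow> XX (T \<omega>)"
    and "skew_product T f \<in> measurable (fibered_space M X XX) (fibered_space M X XX)"
    and "fiber_disintegration M X XX \<nu> \<mu>h"
    and "A \<in> borel_measurable X"
    and "C > 0" and "c > 0" and "\<epsilon>\<^sub>0 > 0"
    and "\<And>\<epsilon> n. \<lbrakk>0 < \<epsilon>; \<epsilon> < \<epsilon>\<^sub>0; n \<ge> 1\<rbrakk> \<Longrightarrow>
           measure \<mu>h {(\<omega>, x) \<in> space \<mu>h. fiber_sum T f A n \<omega> x \<ge> \<epsilon> * real n}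
             \<le> C * exp (- c * \<epsilon>\<^sup>2 * real n)"
  shows "\<forall>\<epsilon> p. 0 < \<epsilon> \<and> \<epsilon> < \<epsilon>\<^sub>0 \<and> 1 \<le> p \<longrightarrow>
           (\<exists>K. K \<in> borel_measurable M \<and> integrable M (\<lambda>\<omega>. \<bar>K \<omega>\<bar> powr p) \<and>
             (AE \<omega> in M. \<forall>n\<ge>1.
               measure (\<nu> \<omega>) {x \<in> space (\<nu> \<omega>). fiber_sum T f A n \<omega> x \<ge> \<epsilon> * real n}
                 \<le> K \<omega> * exp (- \<epsilon>\<^sup>2 * (c / (p + 2)) * real n)))"
proof (intro allI impI)
  fix \<epsilon> p :: real
  assume \<epsilon>p: "0 < \<epsilon> \<and> \<epsilon> < \<epsilon>\<^sub>0 \<and> 1 \<le> p"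
  define B where "B n = {(\<omega>, x) \<in> space \<mu>h. fiber_sum T f A n \<omega> x \<ge> \<epsilon> * real n}" for n
  define g where
    "g n \<omega> = measure (\<nu> \<omega>) {x \<in> space (\<nu> \<omega>). fiber_sum T f A n \<omega> x \<ge> \<epsilon> * real n}" for n \<omega>
  have prob_\<mu>h: "prob_space \<mu>h"
    and sets_\<mu>h: "sets \<mu>h = sets (fibered_space M X XX)"
    and prob_\<nu>: "\<And>\<omega>. \<omega> \<in> space M \<Longrightarrow> prob_space (\<nu> \<omega>)"
    and sets_\<nu>: "\<And>\<omega>. \<omega> \<in> space M \<Longrightarrow> sets (\<nu> \<omega>) = sets (restrict_space X (XX \<omega>))"
    and slice_meas: "\<And>B. B \<in> sets \<mu>h \<Longrightarrow> (\<lambda>\<omega>. emeasure (\<nu> \<omega>) (Pair \<omega> -` B)) \<in> borel_measurable M"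
    and slice_int: "\<And>B. B \<in> sets \<mu>h \<Longrightarrow>
      emeasure \<mu>h B = (\<integral>\<^sup>+\<omega>. emeasure (\<nu> \<omega>) (Pair \<omega> -` B) \<partial>M)"
    using assms(8) unfolding fiber_disintegration_def by blast+
  have space_\<mu>h: "space \<mu>h = (SIGMA \<omega>:space M. XX \<omega>)"
    using sets_eq_imp_space_eq[OF sets_\<mu>h] space_fibered_space[of M XX X] assms(4) by simp
  have space_\<nu>: "space (\<nu> \<omega>) = XX \<omega>" if "\<omega> \<in> space M" for \<omega>
    using sets_eq_imp_space_eq[OF sets_\<nu>[OF that]] assms(4)[OF that]
    by (auto simp: space_restrict_space)
  have "(\<lambda>(\<omega>, x). fiber_sum T f A n \<omega> x) \<in> borel_measurable \<mu>h" for n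
    using fiber_sum_measurable[OF assms(7,9)] by (simp cong: measurable_cong_sets add: sets_\<mu>h)
  then have "{z \<in> space \<mu>h. \<epsilon> * real n \<le> (\<lambda>(\<omega>, x). fiber_sum T f A n \<omega> x) z} \<in> sets \<mu>h" for n
    by (rule borel_measurable_le[OF borel_measurable_const])
  then have B_sets: "B n \<in> sets \<mu>h" for n
    by (simp add: B_def case_prod_unfold)
  have slice: "emeasure (\<nu> \<omega>) (Pair \<omega> -` B n) = ennreal (g n \<omega>)" if "\<omega> \<in> space M" for n \<omega>
  proof -
    have "Pair \<omega> -` B n = {x \<in> space (\<nu> \<omega>). fiber_sum T f A n \<omega> x \<ge> \<epsilon> * real n}"
      using that by (auto simp: B_def space_\<mu>h space_\<nu>)
    then show ?thesis
      using finite_measure.emeasure_eq_measure[OF prob_space.finite_measure[OF prob_\<nu>[OF that]]]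
      by (simp add: g_def)
  qed
  have g_meas: "g n \<in> borel_measurable M" for n
  proof -
    have "(\<lambda>\<omega>. enn2real (emeasure (\<nu> \<omega>) (Pair \<omega> -` B n))) \<in> borel_measurable M"
      using slice_meas[OF B_sets] by measurable
    then show ?thesis
      by (rule measurable_cong[THEN iffD1, rotated]) (simp add: slice g_def)
  qed
  have g_mean: "(\<integral>\<^sup>+\<omega>. ennreal (g n \<omega>) \<partial>M) \<le> ennreal (C * exp (- (c * \<epsilon>\<^sup>2) * real n))"
    if "n \<ge> 1" for n
  proof -
    have "(\<integral>\<^sup>+\<omega>. ennreal (g n \<omega>) \<partial>M) = emeasure \<mu>h (B n)"
      unfolding slice_int[OF B_sets] by (intro nn_integral_cong) (simp add: slice)
    also have "\<dots> = ennreal (measure \<mu>h (B n))"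
      using prob_\<mu>h by (intro finite_measure.emeasure_eq_measure prob_space.finite_measure)
    also have "\<dots> \<le> ennreal (C * exp (- (c * \<epsilon>\<^sup>2) * real n))"
      using assms(13)[of \<epsilon> n] \<epsilon>p that by (intro ennreal_leI) (simp add: B_def)
    finally show ?thesis .
  qed
  have rate: "p * (\<epsilon>\<^sup>2 * (c / (p + 2))) < c * \<epsilon>\<^sup>2"
  proof -
    have "p / (p + 2) < 1" "c * \<epsilon>\<^sup>2 > 0" using \<epsilon>p assms(11) by auto
    then have "(p / (p + 2)) * (c * \<epsilon>\<^sup>2) < 1 * (c * \<epsilon>\<^sup>2)" by (intro mult_strict_right_mono)
    then show ?thesis by (simp add: mult_ac)
  qed
  have "\<exists>K. K \<in> borel_measurable M \<and> integrable M (\<lambda>\<omega>. \<bar>K \<omega>\<bar> powr p) \<and>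
      (AE \<omega> in M. \<forall>n\<ge>1. g n \<omega> \<le> K \<omega> * exp (- (\<epsilon>\<^sup>2 * (c / (p + 2))) * real n))"
  proof (rule exponential_decay_random_prefactor[OF g_meas _ _ g_mean _ _ rate])
    show "g n \<omega> \<le> 1" if "\<omega> \<in> space M" for n \<omega>
      unfolding g_def by (rule prob_space.prob_le_1[OF prob_\<nu>[OF that]])
  qed (use assms(10) \<epsilon>p in \<open>auto simp: g_def\<close>)
  then show "\<exists>K. K \<in> borel_measurable M \<and> integrable M (\<lambda>\<omega>. \<bar>K \<omega>\<bar> powr p) \<and>
      (AE \<omega> in M. \<forall>n\<ge>1.
        measure (\<nu> \<omega>) {x \<in> space (\<nu> \<omega>). fiber_sum T f A n \<omega> x \<ge> \<epsilon> * real n}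
          \<le> K \<omega> * exp (- \<epsilon>\<^sup>2 * (c / (p + 2)) * real n))"
    by (simp add: g_def)
qed

end
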